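(* Consider a two-phase linear cake-eating problem on $X=[0,b]$, $b>0$, with associated $T^+\in\mathbb{N}^0$ and $T^-\in\mathbb{N}$, $T^+<T^-$. Let $T\in\mathbb{N}^0$ and let $x\in X$ be arbitrary. If $\langle x_t\mid t\ge T\rangle\in\mathcal{S}^T(x)$, then $x_t=x$ for all $t\le T^+$ and $x_t=0$ for all $t\ge T^-$.
   Context: $\mathbb{N}^0=\{0,1,2,\dots\}$, $\mathbb{N}=\{1,2,\dots\}$. A linear cake-eating problem on $X=[0,b]$ is given by a sequence of real numbers $\langle p^{(t)}\mid t\in\mathbb{N}^0\rangle$ with $\sum_{t=0}^\infty|p^{(t)}|<+\infty$, together with the constraint sets $\Omega_t=\Omega=\{(z,y)\mid z\in[0,b],\ y\in[0,z]\}$ for all $t\in\mathbb{N}^0$. It is a two-phase linear cake-eating problem if there exist $T^+\in\mathbb{N}^0$ and $T^-\in\mathbb{N}$ with $T^+<T^-$ such that $p^{(t)}>0$ for all $t\le T^+$ and $p^{(t)}<0$ for all $t\ge T^-$. For $T\in\mathbb{N}^0$ and $x\in X$, $\mathcal{F}^T(x)$ is the set of sequences $\langle x_t\mid t\ge T\rangle$, indexed by the integers $t\ge T$, with $x_T=x$ and $(x_t,x_{t+1})\in\Omega$ (i.e. $0\le x_{t+1}\le x_t\le b$) for all $t\ge T$; $\mathcal{S}^T(x)$ is the set of maximizers of $\sum_{t=T}^\infty p^{(t)}x_t$ over $\langle x_t\mid t\ge T\rangle\in\mathcal{F}^T(x)$.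
   Formalization: The claim x_t = 0 for all t ≥ T^- is asserted only for indices t > T, because when T ≥ T^- and x > 0 the prescribed initial value x_T = x makes the literal claim false at t = T. *)

theory Defs
  imports Complex_Main
begin

definition Omega :: "real \<Rightarrow> (real \<times> real) set" where
  "Omega b = {(z, y). z \<in> {0..b} \<and> y \<in> {0..z}}"

definition linear_cake_eating :: "(nat \<Rightarrow> real) \<Rightarrow> bool" where
  "linear_cake_eating p \<longleftrightarrow> summable (\<lambda>t. \<bar>p t\<bar>)"

definition two_phase_at :: "(nat \<Rightarrow> real) \<Rightarrow> nat \<Rightarrow> nat \<Rightarrow> bool" where
  "two_phase_at p Tp Tm \<longleftrightarrow> Tp < Tm \<and> (\<forall>t\<le>Tp. p t > 0) \<and> (\<forall>t\<ge>Tm. p t < 0)"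

definition two_phase_linear_cake_eating :: "(nat \<Rightarrow> real) \<Rightarrow> nat \<Rightarrow> nat \<Rightarrow> bool" where
  "two_phase_linear_cake_eating p Tp Tm \<longleftrightarrow> linear_cake_eating p \<and> two_phase_at p Tp Tm"

text \<open>A sequence indexed by the integers \<open>t \<ge> T\<close> is a function on all of \<open>nat\<close>;
  its values below \<open>T\<close> are unconstrained and enter neither the feasibility condition nor
  the objective.\<close>

definition feasible :: "real \<Rightarrow> nat \<Rightarrow> real \<Rightarrow> (nat \<Rightarrow> real) set" where
  "feasible b T x = {xs. xs T = x \<and> (\<forall>t\<ge>T. (xs t, xs (Suc t)) \<in> Omega b)}"

definition objective :: "(nat \<Rightarrow> real) \<Rightarrow> nat \<Rightarrow> (nat \<Rightarrow> real) \<Rightarrow> real" where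
  "objective p T xs = (\<Sum>s. p (T + s) * xs (T + s))"

definition solutions :: "real \<Rightarrow> (nat \<Rightarrow> real) \<Rightarrow> nat \<Rightarrow> real \<Rightarrow> (nat \<Rightarrow> real) set" where
  "solutions b p T x = {xs. is_arg_max (objective p T) (\<lambda>ys. ys \<in> feasible b T x) xs}"

text \<open>If \<open>T \<ge> T\<^sup>-\<close>, the prescribed initial value \<open>x\<^sub>T = x\<close> need not be
  \<open>0\<close>, so \<open>x\<^sub>t = 0\<close> for \<open>t \<ge> T\<^sup>-\<close> can only be claimed of the
  terms with \<open>t > T\<close>. For \<open>T < T\<^sup>-\<close> this restriction is automatic.\<close>

end

(* Flattening xs to x up to Tp and to 0 from Tm on stays feasible and does not lower any single
   term of the objective, so at an optimum every term must already agree; p t is nonzero in both phases. *)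
theory Submission
  imports Defs
begin

lemma feasible_step:
  assumes "xs \<in> feasible b T x" "T \<le> t"
  shows "0 \<le> xs (Suc t)" "xs (Suc t) \<le> xs t" "0 \<le> xs t" "xs t \<le> b"
  using assms by (auto simp: feasible_def Omega_def)

lemma feasible_le_start:
  assumes "xs \<in> feasible b T x" "T \<le> t"
  shows "xs t \<le> x"
  using assms(2)
proof (induction t rule: dec_induct)
  case base
  then show ?case using assms(1) by (simp add: feasible_def)
next
  case (step n)
  then show ?case using feasible_step(2)[OF assms(1), of n] by linarith
qed

text \<open>Feasible values lie in \<open>[0, b]\<close>, so \<open>b\<close> times the absolutely
  summable \<open>p\<close> dominates the terms. This makes \<open>objective\<close> a genuine sum,
  so that two objectives can be subtracted term by term.\<close>

lemma summable_objective:
  assumes "linear_cake_eating p" "xs \<in> feasible b T x"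
  shows "summable (\<lambda>s. p (T + s) * xs (T + s))"
proof (rule summable_comparison_test')
  have "summable (\<lambda>s. \<bar>p (s + T)\<bar>)"
    using assms(1) unfolding linear_cake_eating_def by (subst summable_iff_shift)
  then show "summable (\<lambda>s. \<bar>p (T + s)\<bar> * b)"
    by (simp add: add.commute summable_mult2)
next
  fix s
  show "norm (p (T + s) * xs (T + s)) \<le> \<bar>p (T + s)\<bar> * b"
    using feasible_step(3,4)[OF assms(2), of "T + s"]
    by (auto simp: abs_mult intro!: mult_left_mono)
qed

text \<open>The termwise gains of \<open>ys\<close> over \<open>xs\<close> are nonnegative, while
  optimality of \<open>xs\<close> keeps their sum from being positive. A series of nonnegative terms
  with sum 0 vanishes identically.\<close>

lemma solution_term_eq:
  assumes p: "linear_cake_eating p"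
    and xs: "xs \<in> solutions b p T x"
    and ys: "ys \<in> feasible b T x"
    and le: "\<And>t. T \<le> t \<Longrightarrow> p t * xs t \<le> p t * ys t"
    and t: "T \<le> t"
  shows "p t * xs t = p t * ys t"
proof -
  have fxs: "xs \<in> feasible b T x" and opt: "\<not> objective p T xs < objective p T ys"
    using xs ys by (auto simp: solutions_def is_arg_max_def)
  define d where "d s = p (T + s) * ys (T + s) - p (T + s) * xs (T + s)" for s
  note sx = summable_objective[OF p fxs] and sy = summable_objective[OF p ys]
  have d_nonneg: "0 \<le> d s" for s
    using le[of "T + s"] by (simp add: d_def)
  have d_summable: "summable d"
    unfolding d_def by (intro summable_diff sx sy)
  have "suminf d = objective p T ys - objective p T xs"
    unfolding d_def objective_def by (rule suminf_diff[OF sy sx, symmetric])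
  then have "suminf d = 0"
    using opt suminf_nonneg[OF d_summable d_nonneg] by linarith
  then have "d (t - T) = 0"
    using suminf_eq_zero_iff[OF d_summable d_nonneg] by blast
  then show ?thesis using t by (auto simp: d_def)
qed

theorem mainTheorem11:
  fixes b x :: real and p xs :: "nat \<Rightarrow> real" and Tp Tm T :: nat
  assumes "b > 0"
    and "two_phase_linear_cake_eating p Tp Tm"
    and "x \<in> {0..b}"
    and "xs \<in> solutions b p T x"
  shows "(\<forall>t. T \<le> t \<and> t \<le> Tp \<longrightarrow> xs t = x) \<and> (\<forall>t. T < t \<and> Tm \<le> t \<longrightarrow> xs t = 0)"
proof -
  have p: "linear_cake_eating p" and TpTm: "Tp < Tm"
    and pos: "\<And>t. t \<le> Tp \<Longrightarrow> p t > 0" and neg: "\<And>t. Tm \<le> t \<Longrightarrow> p t < 0"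
    using assms(2) by (auto simp: two_phase_linear_cake_eating_def two_phase_at_def)
  have fxs: "xs \<in> feasible b T x"
    using assms(4) by (simp add: solutions_def is_arg_max_def)
  have start: "xs T = x"
    using fxs by (simp add: feasible_def)
  note step = feasible_step[OF fxs] and le_x = feasible_le_start[OF fxs]
  \<comment> \<open>The test \<open>t \<le> T\<close> comes first so that \<open>ys T = x\<close>
    survives even when \<open>Tm \<le> T\<close>. Strictly between the phases the sign of
    \<open>p\<close> is unknown, so \<open>xs\<close> is kept there.\<close>
  define ys where
    "ys t = (if t \<le> T \<or> t \<le> Tp then x else if Tm \<le> t then 0 else xs t)" for t
  \<comment> \<open>Only the joints need care: passing from \<open>x\<close> to \<open>xs\<close>,
    from \<open>xs\<close> to 0, or directly from \<open>x\<close> to 0 never increases, because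
    \<open>xs\<close> stays between 0 and \<open>x\<close> from \<open>T\<close> on.\<close>
  have "(ys t, ys (Suc t)) \<in> Omega b" if Tt: "T \<le> t" for t
    using that assms(3) step[of t] le_x[of t] le_x[of "Suc t"]
    by (auto simp: ys_def Omega_def)
  then have fys: "ys \<in> feasible b T x"
    by (simp add: feasible_def ys_def)
  have le: "p t * xs t \<le> p t * ys t" if Tt: "T \<le> t" for t
  proof -
    \<comment> \<open>In the first and last cases \<open>ys t = xs t\<close>. In the other two,
      \<open>ys\<close> is raised to \<open>x\<close> where \<open>p\<close> is positive or lowered
      to 0 where \<open>p\<close> is negative.\<close>
    consider "t = T" | "t \<le> Tp" | "T < t" "Tp < t" "Tm \<le> t" | "T < t" "Tp < t" "t < Tm"
      using Tt by linarith
    then show ?thesis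
    proof cases
      case 2
      then show ?thesis
        using pos[of t] le_x[OF Tt] by (simp add: ys_def)
    next
      case 3
      then show ?thesis
        using neg[of t] step(3)[OF Tt] by (simp add: ys_def mult_nonpos_nonneg)
    qed (auto simp: ys_def start)
  qed
  note eq = solution_term_eq[OF p assms(4) fys le]
  show ?thesis
  proof (intro conjI allI impI)
    fix t assume "T \<le> t \<and> t \<le> Tp"
    then show "xs t = x"
      using eq[of t] pos[of t] by (simp add: ys_def)
  next
    fix t assume "T < t \<and> Tm \<le> t"
    \<comment> \<open>\<open>Tp < Tm \<le> t\<close> together with \<open>T < t\<close> excludes the
      first branch of \<open>ys\<close>, so \<open>ys t = 0\<close>, and the nonzero factor
      \<open>p t\<close> cancels.\<close>
    then show "xs t = 0"
      using eq[of t] neg[of t] TpTm by (simp add: ys_def)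
  qed
qed

end
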